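(* Let $\mathcal T\subseteq\mathbb N$ be a symmetric numerical semigroup with $2\notin\mathcal T$, and write $\mathcal T\cap\{0,1,\dots,F(\mathcal T)-1\}=\{0,a_1,\dots,a_n\}$ with $0<a_1<\dots<a_n$. Then the projective monomial curve defined by $a_1<\dots<a_n$ (with $d=a_n$) is arithmetically Gorenstein.
   Context: Let $k$ be an infinite field. A numerical semigroup is a submonoid $\mathcal T\subseteq\mathbb N$ with finite complement; its Frobenius number is $F(\mathcal T)=\max(\mathbb N\setminus\mathcal T)$; $\mathcal T$ is symmetric if for every $b\in\mathbb N$, $b\in\mathcal T$ or $F(\mathcal T)-b\in\mathcal T$. For integers $0<a_1<\dots<a_n=d$ with $\gcd(a_1,\dots,a_n)=1$, the projective monomial curve they define is the curve $\mathcal C\subset\mathbb P^n_k$ with coordinate ring $k[\mathcal C]=k[x_0,\dots,x_n]/I$, $I$ the kernel of the $k$-algebra map $x_0\mapsto v^d$, $x_i\mapsto u^{a_i}v^{d-a_i}$; it is arithmetically Gorenstein if $k[\mathcal C]$ is Gorenstein (Cohen–Macaulay of type 1). *)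

theory Defs
  imports Main "HOL-Library.Poly_Mapping" "HOL-Library.Product_Plus" "HOL-Library.Extended_Nat"
begin

definition numerical_semigroup :: "nat set \<Rightarrow> bool" where
  "numerical_semigroup T \<longleftrightarrow> 0 \<in> T \<and> (\<forall>x\<in>T. \<forall>y\<in>T. x + y \<in> T) \<and> finite (UNIV - T)"

definition frobenius :: "nat set \<Rightarrow> nat" where
  "frobenius T = Max (UNIV - T)"

text \<open>Symmetric: for every b in N, b in T or F(T) - b in T (the latter read in the integers,
  so it requires b <= F(T)).\<close>
definition symmetric_sg :: "nat set \<Rightarrow> bool" where
  "symmetric_sg T \<longleftrightarrow> (\<forall>b. b \<in> T \<or> (b \<le> frobenius T \<and> frobenius T - b \<in> T))"

definition ideal_in :: "'r::comm_ring_1 set \<Rightarrow> 'r set \<Rightarrow> bool" where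
  "ideal_in A I \<longleftrightarrow> I \<subseteq> A \<and> 0 \<in> I \<and> (\<forall>x\<in>I. \<forall>y\<in>I. x + y \<in> I) \<and> (\<forall>r\<in>A. \<forall>x\<in>I. r * x \<in> I)"

definition prime_in :: "'r::comm_ring_1 set \<Rightarrow> 'r set \<Rightarrow> bool" where
  "prime_in A P \<longleftrightarrow> ideal_in A P \<and> 1 \<notin> P \<and> (\<forall>x\<in>A. \<forall>y\<in>A. x * y \<in> P \<longrightarrow> x \<in> P \<or> y \<in> P)"

definition krull_dim :: "'r::comm_ring_1 set \<Rightarrow> enat" where
  "krull_dim A = Sup {enat n | n. \<exists>P. (\<forall>i\<le>n. prime_in A (P i)) \<and> (\<forall>i<n. P i \<subset> P (Suc i))}"

definition gen_ideal :: "'r::comm_ring_1 set \<Rightarrow> 'r list \<Rightarrow> 'r set" where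
  "gen_ideal A xs = {(\<Sum>i<length xs. r i * xs ! i) | r. \<forall>i<length xs. r i \<in> A}"

definition regular_seq :: "'r::comm_ring_1 set \<Rightarrow> 'r set \<Rightarrow> 'r list \<Rightarrow> bool" where
  "regular_seq A m xs \<longleftrightarrow> set xs \<subseteq> m \<and>
     (\<forall>i<length xs. \<forall>y\<in>A. y * xs ! i \<in> gen_ideal A (take i xs) \<longrightarrow> y \<in> gen_ideal A (take i xs)) \<and>
     1 \<notin> gen_ideal A xs"

definition socle :: "'r::comm_ring_1 set \<Rightarrow> 'r set \<Rightarrow> 'r set \<Rightarrow> 'r set" where
  "socle A m J = {r \<in> A. \<forall>y\<in>m. r * y \<in> J}"

text \<open>Gorenstein (= Cohen-Macaulay of type 1) for the ring A with homogeneous maximal ideal m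
  and scalar embedding sc of the field k: there is an A-regular sequence in m whose length equals
  dim A (so depth = dim, i.e. Cohen-Macaulay), and the socle (0 :_{A/J} m) of A/J, J the ideal
  generated by that (maximal) regular sequence, is a 1-dimensional k-vector space (type 1).\<close>
definition gorenstein_wrt :: "('k \<Rightarrow> 'r::comm_ring_1) \<Rightarrow> 'r set \<Rightarrow> 'r set \<Rightarrow> bool" where
  "gorenstein_wrt sc A m \<longleftrightarrow>
     (\<exists>xs. regular_seq A m xs \<and> enat (length xs) = krull_dim A \<and>
        (let J = gen_ideal A xs in
          \<exists>s\<in>socle A m J. s \<notin> J \<and> (\<forall>r\<in>socle A m J. \<exists>c. r - sc c * s \<in> J)))"

text \<open>Multivariate polynomials over 'k in variables x_i (i :: nat), and k[u,v] with monomial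
  u^a v^b encoded by the key (a,b).\<close>

type_synonym 'k mpoly = "(nat \<Rightarrow>\<^sub>0 nat) \<Rightarrow>\<^sub>0 'k"
type_synonym 'k uvpoly = "(nat \<times> nat) \<Rightarrow>\<^sub>0 'k"

definition poly_ring :: "nat \<Rightarrow> 'k::field mpoly set" where
  "poly_ring n = {p. \<forall>mo\<in>Poly_Mapping.keys p. Poly_Mapping.keys mo \<subseteq> {0..n}}"

text \<open>For the list a = [a_1,...,a_n], d = a_n: exponent of the image of x_i in k[u,v].\<close>
definition curve_gen :: "nat list \<Rightarrow> nat \<Rightarrow> nat \<times> nat" where
  "curve_gen a i = (let d = last a in if i = 0 then (0, d) else (a ! (i - 1), d - a ! (i - 1)))"

text \<open>The k-algebra map x_0 |-> v^d, x_i |-> u^{a_i} v^{d - a_i}.\<close>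
definition curve_map :: "nat list \<Rightarrow> 'k::field mpoly \<Rightarrow> 'k uvpoly" where
  "curve_map a p = (\<Sum>mo\<in>Poly_Mapping.keys p. Poly_Mapping.single
       (\<Sum>i\<in>Poly_Mapping.keys mo. (Poly_Mapping.lookup mo i * fst (curve_gen a i), Poly_Mapping.lookup mo i * snd (curve_gen a i)))
       (Poly_Mapping.lookup p mo))"

text \<open>Coordinate ring k[C] = k[x_0..x_n]/I, I = ker(curve_map), realised as the image of
  curve_map (isomorphic by the first isomorphism theorem).\<close>
definition coord_ring :: "nat list \<Rightarrow> 'k::field uvpoly set" where
  "coord_ring a = curve_map a ` poly_ring (length a)"

text \<open>Homogeneous maximal ideal (image of (x_0,...,x_n)): elements with no constant term.\<close>
definition coord_irrelevant :: "nat list \<Rightarrow> 'k::field uvpoly set" where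
  "coord_irrelevant a = {r \<in> coord_ring a. Poly_Mapping.lookup r (0, 0) = 0}"

definition arith_gorenstein :: "'k::field itself \<Rightarrow> nat list \<Rightarrow> bool" where
  "arith_gorenstein _ a \<longleftrightarrow>
     gorenstein_wrt (\<lambda>c::'k. Poly_Mapping.single (0, 0) c)
       (coord_ring a :: 'k uvpoly set) (coord_irrelevant a)"

end

(* Put d = F - 1, the largest a_i. The coordinate ring is the monoid ring of S = {(x, y). x in T, d | x + y}:
   symmetry, together with F - 1, F - 2 in T (here 2 is not in T is used), shows that every element of T
   in (F, F + d) is a sum of two of the a_i, so the m-fold sumset of {0, a_1, ..., a_n} is T intersected with [0, md].
   Hence v^d, u^d is a regular sequence, and the monomials outside (v^d, u^d) are indexed by the
   Apery set of T with respect to d, whose symmetry makes (2d + 1, d - 1) the only socle monomial.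
   The Krull dimension is at least 2 because of the faces of S. It is at most 2 because any three
   elements of k[u,v] are algebraically dependent, and the lexicographically lowest coefficient of
   such a relation would be a unit in the top prime of a chain of length 3. *)
theory Submission
  imports Defs
begin

section \<open>Supports and coefficients of finitely supported functions\<close>

lemma poly_mapping_sum_single:
  fixes p :: "'a \<Rightarrow>\<^sub>0 'b::comm_monoid_add"
  shows "(\<Sum>s\<in>Poly_Mapping.keys p. Poly_Mapping.single s (Poly_Mapping.lookup p s)) = p"
proof (rule poly_mapping_eqI)
  fix k
  show "Poly_Mapping.lookup (\<Sum>s\<in>Poly_Mapping.keys p. Poly_Mapping.single s (Poly_Mapping.lookup p s)) k
      = Poly_Mapping.lookup p k"
    by (simp add: lookup_sum lookup_single when_def in_keys_iff)
qed

text \<open>Expanding both factors into single terms turns a coefficient into a finite sum over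
  pairs of keys, from which later arguments isolate the one contributing pair.\<close>

lemma lookup_mult_keys:
  fixes p q :: "'a::monoid_add \<Rightarrow>\<^sub>0 'b::semiring_0"
  shows "Poly_Mapping.lookup (p * q) k =
    (\<Sum>(s, t)\<in>Poly_Mapping.keys p \<times> Poly_Mapping.keys q.
       Poly_Mapping.lookup p s * Poly_Mapping.lookup q t when s + t = k)"
proof -
  have "p * q = (\<Sum>s\<in>Poly_Mapping.keys p. Poly_Mapping.single s (Poly_Mapping.lookup p s)) *
      (\<Sum>t\<in>Poly_Mapping.keys q. Poly_Mapping.single t (Poly_Mapping.lookup q t))"
    by (simp add: poly_mapping_sum_single)
  also have "\<dots> = (\<Sum>(s, t)\<in>Poly_Mapping.keys p \<times> Poly_Mapping.keys q.
      Poly_Mapping.single (s + t) (Poly_Mapping.lookup p s * Poly_Mapping.lookup q t))"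
    by (simp add: sum_product mult_single sum.cartesian_product)
  finally show ?thesis
    by (simp add: lookup_sum lookup_single case_prod_unfold)
qed

lemma keys_sum_subset:
  assumes "\<And>i. i \<in> I \<Longrightarrow> Poly_Mapping.keys (f i) \<subseteq> K"
  shows "Poly_Mapping.keys (sum f I) \<subseteq> K"
  using assms
proof (induction I rule: infinite_finite_induct)
  case (insert i I)
  then show ?case
    using Poly_Mapping.keys_add[of "f i" "sum f I"] by auto
qed auto

lemma keys_mult_subset:
  assumes "Poly_Mapping.keys p \<subseteq> K" "Poly_Mapping.keys q \<subseteq> L" "\<And>a b. a \<in> K \<Longrightarrow> b \<in> L \<Longrightarrow> a + b \<in> M"
  shows "Poly_Mapping.keys (p * q) \<subseteq> M"
  using Poly_Mapping.keys_mult[of p q] assms by blast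

section \<open>Monomial rings and their monomial ideals\<close>

text \<open>For a submonoid \<open>S\<close> this is the monoid algebra of \<open>S\<close>, taken
  inside the algebra of the ambient monoid.\<close>

definition supported :: "'a set \<Rightarrow> ('a \<Rightarrow>\<^sub>0 'b::zero) set" where
  "supported S = {p. Poly_Mapping.keys p \<subseteq> S}"

definition subring_of :: "'r::comm_ring_1 set \<Rightarrow> bool" where
  "subring_of A \<longleftrightarrow> 1 \<in> A \<and> (\<forall>x\<in>A. - x \<in> A) \<and> (\<forall>x\<in>A. \<forall>y\<in>A. x + y \<in> A \<and> x * y \<in> A)"

definition submonoid :: "'a::comm_monoid_add set \<Rightarrow> bool" where
  "submonoid S \<longleftrightarrow> 0 \<in> S \<and> (\<forall>x\<in>S. \<forall>y\<in>S. x + y \<in> S)"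

lemma submonoid_0: "submonoid S \<Longrightarrow> 0 \<in> S"
  and submonoid_add: "submonoid S \<Longrightarrow> x \<in> S \<Longrightarrow> y \<in> S \<Longrightarrow> x + y \<in> S"
  by (auto simp: submonoid_def)

lemma supported_0 [simp]: "0 \<in> supported S"
  by (simp add: supported_def)

lemma supported_add: "p \<in> supported S \<Longrightarrow> q \<in> supported S \<Longrightarrow> p + q \<in> supported S"
  unfolding supported_def using Poly_Mapping.keys_add[of p q] by auto

lemma supported_single: "s \<in> S \<Longrightarrow> Poly_Mapping.single s c \<in> supported S"
  by (simp add: supported_def)

lemma supported_sum: "(\<And>i. i \<in> I \<Longrightarrow> f i \<in> supported S) \<Longrightarrow> sum f I \<in> supported S"
  unfolding supported_def using keys_sum_subset[of I f S] by auto

lemma supported_mult: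
  "submonoid S \<Longrightarrow> p \<in> supported S \<Longrightarrow> q \<in> supported S \<Longrightarrow> p * q \<in> supported S"
  unfolding supported_def using keys_mult_subset[of p S q S S] by (auto simp: submonoid_def)

lemma supported_uminus:
  fixes p :: "'a \<Rightarrow>\<^sub>0 'b::ab_group_add"
  shows "p \<in> supported S \<Longrightarrow> - p \<in> supported S"
  by (auto simp: supported_def in_keys_iff)

lemma subring_supported:
  fixes S :: "'a::comm_monoid_add set"
  shows "submonoid S \<Longrightarrow> subring_of (supported S :: ('a \<Rightarrow>\<^sub>0 'b::comm_ring_1) set)"
  unfolding subring_of_def
  by (auto simp: supported_add supported_mult supported_uminus submonoid_0 supported_single simp flip: single_one)

text \<open>The quotient is built term by term: each key \<open>s\<close> is written as
  \<open>h s + g\<close> with \<open>h s\<close> in \<open>S\<close>, and its coefficient moves to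
  \<open>h s\<close>.\<close>

lemma supported_shift_divisible:
  fixes p :: "'a::comm_monoid_add \<Rightarrow>\<^sub>0 'b::comm_semiring_1"
  assumes "Poly_Mapping.keys p \<subseteq> (\<lambda>t. t + g) ` S"
  obtains q where "q \<in> supported S" "p = q * Poly_Mapping.single g 1"
proof -
  obtain h where h: "\<And>s. s \<in> Poly_Mapping.keys p \<Longrightarrow> h s \<in> S \<and> s = h s + g"
    using assms by (metis (mono_tags, lifting) image_iff subsetD)
  let ?q = "\<Sum>s\<in>Poly_Mapping.keys p. Poly_Mapping.single (h s) (Poly_Mapping.lookup p s)"
  have "?q * Poly_Mapping.single g 1 = (\<Sum>s\<in>Poly_Mapping.keys p. Poly_Mapping.single s (Poly_Mapping.lookup p s))"
    unfolding sum_distrib_right by (rule sum.cong) (use h in \<open>auto simp: mult_single\<close>)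
  moreover have "?q \<in> supported S"
    by (intro supported_sum supported_single) (use h in auto)
  ultimately show ?thesis
    using that poly_mapping_sum_single[of p] by metis
qed

section \<open>Ideals generated by one or two monomials\<close>

lemma gen_ideal_Nil: "gen_ideal A [] = {0}"
  by (auto simp: gen_ideal_def)

lemma gen_ideal_singleton: "gen_ideal A [x] = {r * x | r. r \<in> A}"
proof -
  have "\<exists>f. r * x = (\<Sum>i<Suc 0. f i * [x] ! i) \<and> (\<forall>i<Suc 0. f i \<in> A)" if "r \<in> A" for r
    by (rule exI[of _ "\<lambda>_. r"]) (use that in auto)
  then show ?thesis
    unfolding gen_ideal_def by auto
qed

lemma gen_ideal_pair: "gen_ideal A [x, y] = {r * x + r' * y | r r'. r \<in> A \<and> r' \<in> A}"
proof -
  have "\<exists>f. r * x + r' * y = (\<Sum>i<Suc (Suc 0). f i * [x, y] ! i) \<and> (\<forall>i<Suc (Suc 0). f i \<in> A)"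
    if "r \<in> A" "r' \<in> A" for r r'
    by (rule exI[of _ "\<lambda>i. if i = 0 then r else r'"]) (use that in auto)
  then show ?thesis
    unfolding gen_ideal_def by auto blast
qed

lemma gen_ideal_monomial:
  fixes S :: "'a::comm_monoid_add set"
  assumes "submonoid S" "g \<in> S"
  shows "gen_ideal (supported S) [Poly_Mapping.single g (1::'b::comm_ring_1)] = supported ((\<lambda>t. t + g) ` S)"
proof (intro equalityI subsetI)
  fix p :: "'a \<Rightarrow>\<^sub>0 'b" assume "p \<in> supported ((\<lambda>t. t + g) ` S)"
  then have "Poly_Mapping.keys p \<subseteq> (\<lambda>t. t + g) ` S"
    by (simp add: supported_def)
  then obtain q where "q \<in> supported S" "p = q * Poly_Mapping.single g 1"
    by (rule supported_shift_divisible)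
  then show "p \<in> gen_ideal (supported S) [Poly_Mapping.single g 1]"
    unfolding gen_ideal_singleton by blast
next
  fix p :: "'a \<Rightarrow>\<^sub>0 'b" assume "p \<in> gen_ideal (supported S) [Poly_Mapping.single g 1]"
  then obtain r where "r \<in> supported S" "p = r * Poly_Mapping.single g 1"
    unfolding gen_ideal_singleton by blast
  then show "p \<in> supported ((\<lambda>t. t + g) ` S)"
    using keys_mult_subset[of r S "Poly_Mapping.single g 1" "{g}" "(\<lambda>t. t + g) ` S"]
    by (auto simp: supported_def)
qed

text \<open>The two shifted copies of \<open>S\<close> may overlap, so the keys of \<open>p\<close>
  are split into those in the first copy and the rest; each part is divisible by its own
  monomial.\<close>

lemma gen_ideal_two_monomials:
  fixes S :: "'a::comm_monoid_add set"
  assumes "submonoid S" "g \<in> S" "h \<in> S"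
  shows "gen_ideal (supported S) [Poly_Mapping.single g (1::'b::comm_ring_1), Poly_Mapping.single h 1] =
    supported ((\<lambda>t. t + g) ` S \<union> (\<lambda>t. t + h) ` S)"
proof (intro equalityI subsetI)
  fix p :: "'a \<Rightarrow>\<^sub>0 'b" assume p: "p \<in> supported ((\<lambda>t. t + g) ` S \<union> (\<lambda>t. t + h) ` S)"
  let ?G = "Poly_Mapping.keys p \<inter> (\<lambda>t. t + g) ` S" and ?H = "Poly_Mapping.keys p - (\<lambda>t. t + g) ` S"
  let ?m = "\<lambda>s. Poly_Mapping.single s (Poly_Mapping.lookup p s)"
  have "p = sum ?m (?G \<union> ?H)"
    by (simp add: Int_Diff_Un poly_mapping_sum_single)
  also have "\<dots> = sum ?m ?G + sum ?m ?H"
    by (intro sum.union_disjoint) auto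
  finally have eq: "p = sum ?m ?G + sum ?m ?H" .
  have "Poly_Mapping.keys (sum ?m ?G) \<subseteq> (\<lambda>t. t + g) ` S"
    by (rule keys_sum_subset) auto
  then obtain q where "q \<in> supported S" "sum ?m ?G = q * Poly_Mapping.single g 1"
    by (rule supported_shift_divisible)
  moreover have "Poly_Mapping.keys (sum ?m ?H) \<subseteq> (\<lambda>t. t + h) ` S"
    by (rule keys_sum_subset) (use p in \<open>auto simp: supported_def\<close>)
  then obtain q' where "q' \<in> supported S" "sum ?m ?H = q' * Poly_Mapping.single h 1"
    by (rule supported_shift_divisible)
  ultimately show "p \<in> gen_ideal (supported S) [Poly_Mapping.single g 1, Poly_Mapping.single h 1]"
    unfolding gen_ideal_pair using eq by auto
next
  fix p :: "'a \<Rightarrow>\<^sub>0 'b" assume "p \<in> gen_ideal (supported S) [Poly_Mapping.single g 1, Poly_Mapping.single h 1]"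
  then obtain r r' where r: "r \<in> supported S" "r' \<in> supported S"
      and p: "p = r * Poly_Mapping.single g 1 + r' * Poly_Mapping.single h 1"
    unfolding gen_ideal_pair by blast
  have "r * Poly_Mapping.single g 1 \<in> supported ((\<lambda>t. t + g) ` S)"
    using r assms unfolding gen_ideal_monomial[OF assms(1,2), symmetric] gen_ideal_singleton by blast
  moreover have "r' * Poly_Mapping.single h 1 \<in> supported ((\<lambda>t. t + h) ` S)"
    using r assms unfolding gen_ideal_monomial[OF assms(1,3), symmetric] gen_ideal_singleton by blast
  ultimately show "p \<in> supported ((\<lambda>t. t + g) ` S \<union> (\<lambda>t. t + h) ` S)"
    unfolding p by (intro supported_add) (auto simp: supported_def)
qed

text \<open>By cancellation among exponents, \<open>s\<close> is the only key that the shift by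
  \<open>g\<close> moves to \<open>s + g\<close>.\<close>

lemma lookup_mult_single_shift:
  fixes p :: "'a::cancel_comm_monoid_add \<Rightarrow>\<^sub>0 'b::comm_semiring_1"
  shows "Poly_Mapping.lookup (p * Poly_Mapping.single g c) (s + g) = Poly_Mapping.lookup p s * c"
proof (cases "c = 0")
  case False
  have "Poly_Mapping.lookup (p * Poly_Mapping.single g c) (s + g) =
      (\<Sum>t\<in>Poly_Mapping.keys p. Poly_Mapping.lookup p t * c when t + g = s + g)"
    using False unfolding lookup_mult_keys
    by (simp add: sum.cartesian_product[symmetric])
  also have "\<dots> = Poly_Mapping.lookup p s * c"
    by (simp add: when_def in_keys_iff)
  finally show ?thesis .
qed simp

section \<open>Krull dimension\<close>

lemma subring_of_power: "subring_of A \<Longrightarrow> x \<in> A \<Longrightarrow> x ^ n \<in> A"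
  by (induction n) (auto simp: subring_of_def)

lemma prime_in_power:
  assumes "prime_in A P" "subring_of A" "x \<in> A" "x ^ n \<in> P"
  shows "x \<in> P"
  using assms(4)
proof (induction n)
  case 0
  then show ?case using assms(1) by (simp add: prime_in_def)
next
  case (Suc n)
  then show ?case
    using assms(1,3) subring_of_power[OF assms(2,3)] by (auto simp: prime_in_def)
qed

lemma subring_of_0: "subring_of A \<Longrightarrow> 0 \<in> A"
  unfolding subring_of_def by (metis add.right_inverse)

lemma subring_of_sum: "subring_of A \<Longrightarrow> (\<And>i. i \<in> I \<Longrightarrow> f i \<in> A) \<Longrightarrow> sum f I \<in> A"
  by (induction I rule: infinite_finite_induct) (auto simp: subring_of_0, auto simp: subring_of_def)

lemma sum_lessThan_split:
  fixes h :: "nat \<Rightarrow> 'b::comm_monoid_add"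
  shows "sum h {..<m + n} = sum h {..<m} + (\<Sum>i<n. h (i + m))"
  by (induction n) (simp_all add: add.assoc add.commute[of m])

text \<open>Dividing the relation by the largest power of \<open>x\<close> (which is not in \<open>P\<close>) leaves a
  relation in \<open>P\<close> whose constant term is \<open>f i0\<close>.\<close>
lemma lowest_coefficient_in_larger_prime:
  assumes A: "subring_of A" and P: "prime_in A P" and Q: "prime_in A Q" and "P \<subseteq> Q"
    and x: "x \<in> Q" "x \<notin> P" and f: "\<And>i. f i \<in> A"
    and rel: "(\<Sum>i<N. f i * x ^ i) \<in> P" and low: "\<And>i. i < i0 \<Longrightarrow> f i = 0" and "i0 < N"
  shows "f i0 \<in> Q"
proof -
  have xA: "x \<in> A"
    using Q x by (auto simp: prime_in_def ideal_in_def)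
  define M where "M = N - Suc i0"
  have N: "N = i0 + Suc M"
    using \<open>i0 < N\<close> by (simp add: M_def)
  define g where "g = (\<Sum>i<M. f (Suc (i + i0)) * x ^ i)"
  have gA: "g \<in> A"
    unfolding g_def
    by (rule subring_of_sum[OF A]) (use A f subring_of_power[OF A xA] in \<open>auto simp: subring_of_def\<close>)
  have "(\<Sum>i<N. f i * x ^ i) = (\<Sum>i<i0. f i * x ^ i) + (\<Sum>i<Suc M. f (i + i0) * x ^ (i + i0))"
    unfolding N by (rule sum_lessThan_split)
  also have "\<dots> = x ^ i0 * (f i0 + x * g)"
    unfolding sum.lessThan_Suc_shift g_def
    by (simp add: low power_add sum_distrib_left algebra_simps)
  finally have "x ^ i0 * (f i0 + x * g) \<in> P"
    using rel by simp
  moreover have "x ^ i0 \<in> A" "x ^ i0 \<notin> P" "f i0 + x * g \<in> A"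
    using prime_in_power[OF P A xA] x(2) A f gA xA subring_of_power[OF A xA]
    by (auto simp: subring_of_def)
  ultimately have "f i0 + x * g \<in> Q"
    using P \<open>P \<subseteq> Q\<close> unfolding prime_in_def by blast
  moreover have "- g * x \<in> Q"
    using Q x(1) gA A unfolding prime_in_def ideal_in_def subring_of_def by blast
  ultimately have "(f i0 + x * g) + (- g * x) \<in> Q"
    using Q unfolding prime_in_def ideal_in_def by blast
  then show ?thesis by (simp add: algebra_simps)
qed

section \<open>Algebraic dependence of three elements of \<open>k[u,v]\<close>\<close>

text \<open>Gaussian elimination by induction on the equations: an unknown \<open>p\<close> with
  nonzero coefficient in the equation \<open>b\<close> is eliminated, leaving one equation and one
  unknown fewer.\<close>

lemma homogeneous_system_nontrivial_solution:
  fixes M :: "'i \<Rightarrow> 'b \<Rightarrow> 'k::field"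
  assumes "finite B" "finite I" "card B < card I"
  shows "\<exists>c. (\<exists>i\<in>I. c i \<noteq> 0) \<and> (\<forall>b\<in>B. (\<Sum>i\<in>I. c i * M i b) = 0)"
  using assms
proof (induction B arbitrary: I M rule: finite_induct)
  case empty
  then have "I \<noteq> {}" by auto
  then show ?case by (intro exI[of _ "\<lambda>_. 1"]) auto
next
  case (insert b B)
  show ?case
  proof (cases "\<forall>i\<in>I. M i b = 0")
    case True
    then show ?thesis
      using insert.IH[of I M] insert.prems insert.hyps by auto
  next
    case False
    then obtain p where p: "p \<in> I" "M p b \<noteq> 0" by blast
    let ?J = "I - {p}"
    have "card B < card ?J"
      using insert.prems insert.hyps p(1) by (simp add: card_Diff_singleton)
    then obtain c where c: "\<exists>i\<in>?J. c i \<noteq> 0"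
        "\<forall>x\<in>B. (\<Sum>i\<in>?J. c i * (M i x - M i b / M p b * M p x)) = 0"
      using insert.IH[of ?J "\<lambda>i x. M i x - M i b / M p b * M p x"] insert.prems(1) by blast
    \<comment> \<open>\<open>- s\<close> is the value of the unknown \<open>p\<close> that makes the
      equation \<open>b\<close> hold.\<close>
    define s where "s = (\<Sum>i\<in>?J. c i * M i b) / M p b"
    have sum: "(\<Sum>i\<in>I. (c(p := - s)) i * M i x) = (\<Sum>i\<in>?J. c i * M i x) - s * M p x" for x
      using insert.prems(1) p(1) by (simp add: sum.remove)
    have reduced: "(\<Sum>i\<in>?J. c i * M i x) - s * M p x = (\<Sum>i\<in>?J. c i * (M i x - M i b / M p b * M p x))" for x
      unfolding s_def by (simp add: right_diff_distrib sum_subtractf sum_divide_distrib sum_distrib_right mult.assoc)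
    have "(\<Sum>i\<in>?J. c i * M i x) - s * M p x = 0" if "x \<in> insert b B" for x
    proof (cases "x = b")
      case True
      then show ?thesis using p(2) by (simp add: s_def)
    next
      case False
      then show ?thesis unfolding reduced using that c(2) by blast
    qed
    then have "\<forall>x\<in>insert b B. (\<Sum>i\<in>I. (c(p := - s)) i * M i x) = 0"
      unfolding sum by blast
    moreover have "\<exists>i\<in>I. (c(p := - s)) i \<noteq> 0"
      using c(1) by auto
    ultimately show ?thesis by blast
  qed
qed

abbreviation degree_box :: "nat \<Rightarrow> (nat \<times> nat) set" where
  "degree_box D \<equiv> {0..D} \<times> {0..D}"

lemma keys_power_degree_box:
  fixes x :: "(nat \<times> nat) \<Rightarrow>\<^sub>0 'k::comm_ring_1"
  assumes "Poly_Mapping.keys x \<subseteq> degree_box D"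
  shows "Poly_Mapping.keys (x ^ i) \<subseteq> degree_box (i * D)"
proof (induction i)
  case (Suc i)
  show ?case
    unfolding power_Suc by (rule keys_mult_subset[OF assms Suc]) auto
qed (auto simp: zero_prod_def)

text \<open>Dimension count: the \<open>N^3\<close> products of powers with exponents below
  \<open>N\<close> are supported in a box with only \<open>(3 * N * D + 1)^2\<close> points. The sum
  is nested so that it can be read as a polynomial in \<open>x 0\<close>, its coefficients as
  polynomials in \<open>x 1\<close>, and theirs in \<open>x 2\<close>.\<close>

lemma three_algebraically_dependent:
  fixes x :: "nat \<Rightarrow> 'k::field uvpoly"
  obtains N c where "\<exists>i<N. \<exists>j<N. \<exists>l<N. c i j l \<noteq> 0"
    "(\<Sum>i<N. (\<Sum>j<N. (\<Sum>l<N. Poly_Mapping.single 0 (c i j l) * x 2 ^ l) * x 1 ^ j) * x 0 ^ i) = 0"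
proof -
  have "finite (\<Union>m\<in>{0,1,2::nat}. Poly_Mapping.keys (x m))" by simp
  then have "\<exists>D. (\<Union>m\<in>{0,1,2}. Poly_Mapping.keys (x m)) \<subseteq> degree_box D"
  proof (induction rule: finite_induct)
    case (insert s F)
    then obtain D where "F \<subseteq> degree_box D" by blast
    then have "insert s F \<subseteq> degree_box (D + fst s + snd s)" by (cases s) auto
    then show ?case by blast
  qed simp
  then obtain D where D: "\<And>m. m \<in> {0,1,2} \<Longrightarrow> Poly_Mapping.keys (x m) \<subseteq> degree_box D"
    by blast
  \<comment> \<open>Chosen so that
    \<open>(3 * N * D + 1)^2 <= N^2 * (3 * D + 1)^2 < N^3\<close>.\<close>
  define N where "N = Suc ((3 * D + 1)\<^sup>2)"
  define I where "I = {..<N} \<times> {..<N} \<times> {..<N}"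
  define B where "B = degree_box (3 * (N * D))"
  define mon where "mon = (\<lambda>(i, j, l). x 2 ^ l * x 1 ^ j * x 0 ^ i)"
  have "3 * (N * D) + 1 \<le> N * (3 * D + 1)"
    by (simp add: N_def)
  then have "(3 * (N * D) + 1)\<^sup>2 \<le> (N * (3 * D + 1))\<^sup>2"
    by (rule power_mono) simp
  also have "\<dots> = N * N * (3 * D + 1)\<^sup>2"
    by (simp only: power2_eq_square mult_ac)
  also have "\<dots> < N * N * N"
    unfolding N_def by simp
  finally have "card B < card I"
    by (simp add: B_def I_def power2_eq_square)
  then obtain c where c: "\<exists>i\<in>I. c i \<noteq> 0"
      "\<forall>b\<in>B. (\<Sum>i\<in>I. c i * Poly_Mapping.lookup (mon i) b) = 0"
    using homogeneous_system_nontrivial_solution[of B I "\<lambda>i. Poly_Mapping.lookup (mon i)"]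
    by (auto simp: B_def I_def)
  have keys_mon: "Poly_Mapping.keys (mon t) \<subseteq> B" if t: "t \<in> I" for t
  proof -
    obtain i j l where ijl: "t = (i, j, l)" by (cases t)
    have "Poly_Mapping.keys (x 2 ^ l * x 1 ^ j) \<subseteq> degree_box (l * D + j * D)"
      by (rule keys_mult_subset[OF keys_power_degree_box keys_power_degree_box]) (use D in auto)
    then have keys: "Poly_Mapping.keys (mon t) \<subseteq> degree_box (l * D + j * D + i * D)"
      unfolding mon_def ijl prod.case
      by (rule keys_mult_subset[OF _ keys_power_degree_box]) (use D in auto)
    have "i * D \<le> N * D" "j * D \<le> N * D" "l * D \<le> N * D"
      using t by (auto simp: I_def ijl)
    then have "l * D + j * D + i * D \<le> 3 * (N * D)" by linarith
    then have "degree_box (l * D + j * D + i * D) \<subseteq> B"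
      unfolding B_def by auto
    with keys show ?thesis by blast
  qed
  have zero: "(\<Sum>t\<in>I. Poly_Mapping.single 0 (c t) * mon t) = 0"
  proof (rule poly_mapping_eqI)
    fix b
    have l: "Poly_Mapping.lookup (Poly_Mapping.single 0 (c t) * mon t) b = c t * Poly_Mapping.lookup (mon t) b" for t
      using lookup_mult_single_shift[of "mon t" 0 "c t" b] by (simp add: mult.commute)
    show "Poly_Mapping.lookup (\<Sum>t\<in>I. Poly_Mapping.single 0 (c t) * mon t) b = Poly_Mapping.lookup 0 b"
    proof (cases "b \<in> B")
      case True
      then show ?thesis using c(2) by (simp add: lookup_sum l)
    next
      case False
      then have "Poly_Mapping.lookup (mon t) b = 0" if "t \<in> I" for t
        using keys_mon[OF that] by (auto simp: in_keys_iff)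
      then show ?thesis by (simp add: lookup_sum l)
    qed
  qed
  show ?thesis
  proof (rule that[of N "\<lambda>i j l. c (i, j, l)"])
    show "\<exists>i<N. \<exists>j<N. \<exists>l<N. c (i, j, l) \<noteq> 0"
      using c(1) by (auto simp: I_def)
    have "(\<Sum>t\<in>I. Poly_Mapping.single 0 (c t) * mon t) =
        (\<Sum>i<N. \<Sum>j<N. \<Sum>l<N. Poly_Mapping.single 0 (c (i, j, l)) * mon (i, j, l))"
      unfolding I_def by (simp add: sum.cartesian_product case_prod_unfold)
    then show "(\<Sum>i<N. (\<Sum>j<N. (\<Sum>l<N. Poly_Mapping.single 0 (c (i, j, l)) * x 2 ^ l) * x 1 ^ j) * x 0 ^ i) = 0"
      using zero by (simp add: mon_def sum_distrib_right mult.assoc)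
  qed
qed

text \<open>Choose \<open>x i\<close> in \<open>P (Suc i)\<close> outside \<open>P i\<close>. A
  nontrivial relation among them lies in \<open>P 0\<close>; passing to the lowest coefficient in
  \<open>x 0\<close>, then \<open>x 1\<close>, then \<open>x 2\<close> climbs one prime each time
  and puts a nonzero constant into \<open>P 3\<close>.\<close>

lemma no_prime_chain_of_length_three:
  fixes A :: "'k::field uvpoly set"
  assumes A: "subring_of A" and const: "\<And>c. Poly_Mapping.single 0 c \<in> A"
    and prime: "\<And>i. i \<le> 3 \<Longrightarrow> prime_in A (P i)" and chain: "\<And>i. i < 3 \<Longrightarrow> P i \<subset> P (Suc i)"
  shows False
proof -
  have "\<exists>y. y \<in> P (Suc i) \<and> y \<notin> P i" if "i < 3" for i
    using chain[OF that] by blast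
  then obtain x where x: "\<And>i. i < 3 \<Longrightarrow> x i \<in> P (Suc i) \<and> x i \<notin> P i"
    by metis
  have xA: "x i \<in> A" if "i < 3" for i
    using x[OF that] prime[of "Suc i"] that by (auto simp: prime_in_def ideal_in_def)
  obtain N c where nz: "\<exists>i<N. \<exists>j<N. \<exists>l<N. c i j l \<noteq> 0"
    and rel: "(\<Sum>i<N. (\<Sum>j<N. (\<Sum>l<N. Poly_Mapping.single 0 (c i j l) * x 2 ^ l) * x 1 ^ j) * x 0 ^ i) = 0"
    by (rule three_algebraically_dependent)
  define f where "f i j = (\<Sum>l<N. Poly_Mapping.single 0 (c i j l) * x 2 ^ l)" for i j
  define g where "g i = (\<Sum>j<N. f i j * x 1 ^ j)" for i
  have mult: "a * b ^ n \<in> A" if "a \<in> A" "b \<in> A" for a b n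
    using that A subring_of_power[OF A that(2)] by (auto simp: subring_of_def)
  have fA: "f i j \<in> A" for i j
    unfolding f_def by (intro subring_of_sum[OF A] mult const xA) simp
  have gA: "g i \<in> A" for i
    unfolding g_def by (intro subring_of_sum[OF A] mult fA xA) simp
  \<comment> \<open>\<open>(i0, j0, l0)\<close> is the lexicographically first index with a nonzero
    coefficient, so \<open>g i\<close> vanishes for \<open>i < i0\<close> and \<open>f i0 j\<close>
    for \<open>j < j0\<close>.\<close>
  define i0 where "i0 = (LEAST i. i < N \<and> (\<exists>j<N. \<exists>l<N. c i j l \<noteq> 0))"
  have i0: "i0 < N \<and> (\<exists>j<N. \<exists>l<N. c i0 j l \<noteq> 0)"
    unfolding i0_def by (rule LeastI_ex) (use nz in blast)
  have low_i: "c i j l = 0" if "i < i0" "j < N" "l < N" for i j l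
    using not_less_Least[OF that(1)[unfolded i0_def]] that i0 by auto
  define j0 where "j0 = (LEAST j. j < N \<and> (\<exists>l<N. c i0 j l \<noteq> 0))"
  have j0: "j0 < N \<and> (\<exists>l<N. c i0 j0 l \<noteq> 0)"
    unfolding j0_def by (rule LeastI_ex) (use i0 in blast)
  have low_j: "c i0 j l = 0" if "j < j0" "l < N" for j l
    using not_less_Least[OF that(1)[unfolded j0_def]] that j0 by auto
  define l0 where "l0 = (LEAST l. l < N \<and> c i0 j0 l \<noteq> 0)"
  have l0: "l0 < N \<and> c i0 j0 l0 \<noteq> 0"
    unfolding l0_def by (rule LeastI_ex) (use j0 in blast)
  have low_l: "c i0 j0 l = 0" if "l < l0" for l
    using not_less_Least[OF that(1)[unfolded l0_def]] that l0 by auto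
  have sub: "P 0 \<subseteq> P 1" "P 1 \<subseteq> P 2" "P 2 \<subseteq> P 3"
    using chain[of 0] chain[of 1] chain[of 2] by (auto simp: numeral_2_eq_2 numeral_3_eq_3)
  have x': "x 0 \<in> P 1" "x 0 \<notin> P 0" "x 1 \<in> P 2" "x 1 \<notin> P 1" "x 2 \<in> P 3" "x 2 \<notin> P 2"
    using x[of 0] x[of 1] x[of 2] by (auto simp: numeral_2_eq_2 numeral_3_eq_3)
  have "0 \<in> P 0"
    using prime[of 0] by (simp add: prime_in_def ideal_in_def)
  then have "(\<Sum>i<N. g i * x 0 ^ i) \<in> P 0"
    using rel by (simp add: g_def f_def)
  then have "g i0 \<in> P 1"
    using i0 by (intro lowest_coefficient_in_larger_prime[OF A prime prime sub(1) x'(1,2) gA])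
      (auto simp: g_def f_def low_i)
  then have "f i0 j0 \<in> P 2"
    unfolding g_def using j0
    by (intro lowest_coefficient_in_larger_prime[OF A prime prime sub(2) x'(3,4) fA])
      (auto simp: f_def low_j)
  then have "Poly_Mapping.single 0 (c i0 j0 l0) \<in> P 3"
    unfolding f_def using l0
    by (intro lowest_coefficient_in_larger_prime[OF A prime prime sub(3) x'(5,6) const])
      (auto simp: low_l)
  then have "Poly_Mapping.single 0 (inverse (c i0 j0 l0)) * Poly_Mapping.single 0 (c i0 j0 l0) \<in> P 3"
    using prime[of 3] const by (auto simp: prime_in_def ideal_in_def)
  then show False
    using prime[of 3] l0 by (simp add: mult_single prime_in_def)
qed

section \<open>Primes attached to faces, and the dimension of a monomial ring\<close>

text \<open>The kernel in \<open>A\<close> of discarding all monomials outside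
  \<open>F\<close>.\<close>

definition vanishing_on :: "(nat \<times> nat) set \<Rightarrow> 'k::field uvpoly set \<Rightarrow> 'k uvpoly set" where
  "vanishing_on F A = {p \<in> A. \<forall>s\<in>F. Poly_Mapping.lookup p s = 0}"

lemma exists_lex_minimal:
  fixes K :: "(nat \<times> nat) set"
  assumes "K \<noteq> {}"
  obtains m n where "(m, n) \<in> K" "\<And>x y. (x, y) \<in> K \<Longrightarrow> m < x \<or> m = x \<and> n \<le> y"
proof -
  define m where "m = (LEAST m. \<exists>n. (m, n) \<in> K)"
  have m: "\<exists>n. (m, n) \<in> K"
    unfolding m_def by (rule LeastI_ex) (use assms in force)
  define n where "n = (LEAST n. (m, n) \<in> K)"
  have "(m, n) \<in> K"
    unfolding n_def by (rule LeastI_ex) (use m in force)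
  moreover have "m < x \<or> m = x \<and> n \<le> y" if "(x, y) \<in> K" for x y
  proof -
    have "m \<le> x"
      unfolding m_def by (rule Least_le) (use that in blast)
    moreover have "n \<le> y" if "(m, y) \<in> K"
      unfolding n_def by (rule Least_le) (use that in blast)
    ultimately show ?thesis
      using that by (cases "m = x") auto
  qed
  ultimately show ?thesis by (rule that)
qed

text \<open>The product of the lexicographically smallest monomials in the face cannot cancel.\<close>
lemma prime_in_vanishing_on_face:
  fixes A :: "'k::field uvpoly set"
  assumes A: "subring_of A" and "0 \<in> F" and face: "\<And>a b. a + b \<in> F \<longleftrightarrow> a \<in> F \<and> b \<in> F"
  shows "prime_in A (vanishing_on F A)"
proof -
  have "p \<in> vanishing_on F A \<or> q \<in> vanishing_on F A"
    if "p \<in> A" "q \<in> A" "p * q \<in> vanishing_on F A" for p q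
  proof (rule ccontr)
    assume "\<not> ?thesis"
    then have p: "Poly_Mapping.keys p \<inter> F \<noteq> {}" and q: "Poly_Mapping.keys q \<inter> F \<noteq> {}"
      using that by (auto simp: vanishing_on_def in_keys_iff)
    obtain m n where mn: "(m, n) \<in> Poly_Mapping.keys p \<inter> F"
        "\<And>x y. (x, y) \<in> Poly_Mapping.keys p \<inter> F \<Longrightarrow> m < x \<or> m = x \<and> n \<le> y"
      using exists_lex_minimal[OF p] by blast
    obtain m' n' where mn': "(m', n') \<in> Poly_Mapping.keys q \<inter> F"
        "\<And>x y. (x, y) \<in> Poly_Mapping.keys q \<inter> F \<Longrightarrow> m' < x \<or> m' = x \<and> n' \<le> y"
      using exists_lex_minimal[OF q] by blast
    let ?k = "(m, n) + (m', n')"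
    have k: "?k \<in> F" using mn(1) mn'(1) face by blast
    \<comment> \<open>As \<open>F\<close> is a face, keys \<open>s\<close> and \<open>t\<close> with
      sum \<open>?k\<close> both lie in \<open>F\<close>; minimality in each factor then forces them
      to be the two minimal keys.\<close>
    have "(if s + t = ?k then Poly_Mapping.lookup p s * Poly_Mapping.lookup q t else 0) =
        (if (s, t) = ((m, n), (m', n')) then Poly_Mapping.lookup p s * Poly_Mapping.lookup q t else 0)"
      if "s \<in> Poly_Mapping.keys p" "t \<in> Poly_Mapping.keys q" for s t
    proof (cases "s + t = ?k")
      case True
      then have "s \<in> F" "t \<in> F" using face k by metis+
      then show ?thesis
        using True mn(2)[of "fst s" "snd s"] mn'(2)[of "fst t" "snd t"] that
        by (cases s; cases t) auto
    qed auto
    then have "Poly_Mapping.lookup (p * q) ?k =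
        (\<Sum>w\<in>Poly_Mapping.keys p \<times> Poly_Mapping.keys q.
          if w = ((m, n), (m', n')) then Poly_Mapping.lookup p (fst w) * Poly_Mapping.lookup q (snd w) else 0)"
      unfolding lookup_mult_keys when_def by (intro sum.cong refl) (simp only: case_prod_unfold mem_Times_iff prod.collapse)
    also have "\<dots> = Poly_Mapping.lookup p (m, n) * Poly_Mapping.lookup q (m', n')"
      using mn(1) mn'(1) by (simp add: in_keys_iff)
    also have "\<dots> \<noteq> 0"
      using mn(1) mn'(1) by (simp add: in_keys_iff)
    finally show False
      using that(3) k by (auto simp: vanishing_on_def)
  qed
  moreover have "r * p \<in> vanishing_on F A" if "r \<in> A" "p \<in> vanishing_on F A" for r p
  proof -
    have "Poly_Mapping.lookup (r * p) k = 0" if "k \<in> F" for k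
      unfolding lookup_mult_keys
    proof (rule sum.neutral, clarify)
      fix a b a' b'
      show "(Poly_Mapping.lookup r (a, b) * Poly_Mapping.lookup p (a', b') when (a, b) + (a', b') = k) = 0"
        using face[of "(a, b)" "(a', b')"] \<open>k \<in> F\<close> \<open>p \<in> _\<close> by (auto simp: when_def vanishing_on_def)
    qed
    then show ?thesis
      using that A by (auto simp: vanishing_on_def subring_of_def)
  qed
  moreover have "1 \<notin> vanishing_on F A"
    using \<open>0 \<in> F\<close> by (auto simp: vanishing_on_def intro!: bexI[of _ 0])
  ultimately show ?thesis
    using A subring_of_0[OF A] unfolding prime_in_def ideal_in_def
    by (auto simp: vanishing_on_def lookup_add subring_of_def)
qed

lemma krull_dim_supported_eq_2:
  fixes S :: "(nat \<times> nat) set"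
  assumes S: "submonoid S" and "(0, d) \<in> S" "(d, 0) \<in> S" "d > 0"
  shows "krull_dim (supported S :: 'k::field uvpoly set) = 2"
proof -
  let ?A = "supported S :: 'k uvpoly set"
  have A: "subring_of ?A" using S by (rule subring_supported)
  \<comment> \<open>The faces shrink from the quadrant to the \<open>v\<close>-axis to the origin,
    so their ideals grow; \<open>u^d\<close> and \<open>v^d\<close> witness the two strict
    inclusions.\<close>
  let ?F = "\<lambda>i::nat. if i = 0 then UNIV else if i = 1 then {s :: nat \<times> nat. fst s = 0} else {0}"
  let ?P = "\<lambda>i. vanishing_on (?F i) ?A"
  have "prime_in ?A (?P i)" for i
    by (rule prime_in_vanishing_on_face[OF A]) (auto simp: zero_prod_def)
  moreover have "?P i \<subset> ?P (Suc i)" if "i < 2" for i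
  proof -
    have "i = 0 \<or> i = 1" using that by auto
    moreover have "Poly_Mapping.single (d, 0) 1 \<in> ?P 1 - ?P 0" "Poly_Mapping.single (0, d) 1 \<in> ?P 2 - ?P 1"
      using assms(2-4) by (auto simp: vanishing_on_def supported_single lookup_single when_def zero_prod_def)
    moreover have "?P 0 \<subseteq> ?P 1" "?P 1 \<subseteq> ?P 2"
      by (auto simp: vanishing_on_def zero_prod_def)
    ultimately show ?thesis by (auto simp: numeral_2_eq_2)
  qed
  ultimately have "\<exists>P. (\<forall>i\<le>2. prime_in ?A (P i)) \<and> (\<forall>i<2::nat. P i \<subset> P (Suc i))"
    by (intro exI[of _ ?P]) blast
  then have lower: "enat 2 \<le> krull_dim ?A"
    unfolding krull_dim_def by (intro Sup_upper) blast
  have "n \<le> 2" if "\<forall>i\<le>n. prime_in ?A (P i)" "\<forall>i<n. P i \<subset> P (Suc i)" for n P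
  proof (rule ccontr)
    assume "\<not> n \<le> 2"
    then have "n \<ge> 3" by simp
    then show False
      using that by (intro no_prime_chain_of_length_three[OF A, of P])
        (auto intro: supported_single submonoid_0[OF S])
  qed
  then have "krull_dim ?A \<le> enat 2"
    unfolding krull_dim_def by (intro Sup_least) auto
  with lower show ?thesis
    by (metis antisym numeral_eq_enat)
qed

section \<open>The monoid of a projective monomial curve\<close>

definition monomial_image :: "nat list \<Rightarrow> (nat \<Rightarrow>\<^sub>0 nat) \<Rightarrow> nat \<times> nat" where
  "monomial_image a mo = (\<Sum>i\<in>Poly_Mapping.keys mo.
     (Poly_Mapping.lookup mo i * fst (curve_gen a i), Poly_Mapping.lookup mo i * snd (curve_gen a i)))"

definition curve_monoid :: "nat list \<Rightarrow> (nat \<times> nat) set" where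
  "curve_monoid a = monomial_image a ` {mo. Poly_Mapping.keys mo \<subseteq> {0..length a}}"

lemma monomial_image_superset:
  assumes "finite I" "Poly_Mapping.keys mo \<subseteq> I"
  shows "monomial_image a mo = (\<Sum>i\<in>I.
     (Poly_Mapping.lookup mo i * fst (curve_gen a i), Poly_Mapping.lookup mo i * snd (curve_gen a i)))"
  unfolding monomial_image_def
  by (rule sum.mono_neutral_left) (use assms in \<open>auto simp: in_keys_iff zero_prod_def\<close>)

lemma monomial_image_add: "monomial_image a (mo + mo') = monomial_image a mo + monomial_image a mo'"
proof -
  let ?I = "Poly_Mapping.keys mo \<union> Poly_Mapping.keys mo'"
  have "finite ?I" by simp
  then show ?thesis
    using Poly_Mapping.keys_add[of mo mo']
    by (simp add: monomial_image_superset[of ?I] lookup_add algebra_simps flip: sum.distrib)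
qed

lemma submonoid_curve_monoid: "submonoid (curve_monoid a)"
proof -
  have "0 \<in> curve_monoid a"
    unfolding curve_monoid_def by (rule image_eqI[of _ _ 0]) (auto simp: monomial_image_def)
  moreover have "monomial_image a mo + monomial_image a mo' \<in> curve_monoid a"
    if "Poly_Mapping.keys mo \<subseteq> {0..length a}" "Poly_Mapping.keys mo' \<subseteq> {0..length a}" for mo mo'
    unfolding curve_monoid_def
    by (rule image_eqI[of _ _ "mo + mo'"]) (use that Poly_Mapping.keys_add[of mo mo'] in \<open>auto simp: monomial_image_add\<close>)
  ultimately show ?thesis
    unfolding submonoid_def by (auto simp: curve_monoid_def)
qed

lemma curve_gen_in_curve_monoid: "i \<le> length a \<Longrightarrow> curve_gen a i \<in> curve_monoid a"
  unfolding curve_monoid_def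
  by (rule image_eqI[of _ _ "Poly_Mapping.single i 1"]) (auto simp: monomial_image_def)

text \<open>With the two preceding lemmas this identifies \<open>curve_monoid a\<close> as the
  submonoid generated by the points \<open>curve_gen a i\<close>.\<close>

lemma curve_monoid_subset:
  assumes S: "submonoid S" and gen: "\<And>i. i \<le> length a \<Longrightarrow> curve_gen a i \<in> S"
  shows "curve_monoid a \<subseteq> S"
proof -
  have multiple: "(n * fst g, n * snd g) \<in> S" if "g \<in> S" for g n
  proof (induction n)
    case 0
    then show ?case using submonoid_0[OF S] by (simp add: zero_prod_def)
  next
    case (Suc n)
    then show ?case using submonoid_add[OF S that Suc] by (cases g) simp
  qed
  have sum_mem: "sum h I \<in> S" if "\<And>i. i \<in> I \<Longrightarrow> h i \<in> S" for h and I :: "nat set"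
    using that by (induction I rule: infinite_finite_induct) (auto simp: submonoid_0[OF S] submonoid_add[OF S])
  have "monomial_image a mo \<in> S" if "Poly_Mapping.keys mo \<subseteq> {0..length a}" for mo
    unfolding monomial_image_def by (rule sum_mem, rule multiple, rule gen) (use that in auto)
  then show ?thesis
    unfolding curve_monoid_def by blast
qed

lemma curve_map_superset:
  assumes "finite M" "Poly_Mapping.keys p \<subseteq> M"
  shows "curve_map a p = (\<Sum>mo\<in>M. Poly_Mapping.single (monomial_image a mo) (Poly_Mapping.lookup p mo))"
  unfolding curve_map_def monomial_image_def[symmetric]
  by (rule sum.mono_neutral_left) (use assms in \<open>auto simp: in_keys_iff\<close>)

text \<open>The curve map sends monomials to monomials. Conversely, each key \<open>s\<close> of
  \<open>q\<close> lifts to a monomial \<open>h s\<close>; \<open>h\<close> is injective because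
  \<open>monomial_image a\<close> recovers \<open>s\<close>, so coefficients of the lift do not
  mix.\<close>

lemma coord_ring_eq_supported: "(coord_ring a :: 'k::field uvpoly set) = supported (curve_monoid a)"
proof (intro equalityI subsetI)
  fix q :: "'k uvpoly" assume "q \<in> coord_ring a"
  then obtain p where p: "p \<in> poly_ring (length a)" "q = curve_map a p"
    by (auto simp: coord_ring_def)
  show "q \<in> supported (curve_monoid a)"
    unfolding p(2) curve_map_superset[OF finite_keys order_refl]
    by (intro supported_sum supported_single) (use p(1) in \<open>auto simp: poly_ring_def curve_monoid_def\<close>)
next
  fix q :: "'k uvpoly" assume "q \<in> supported (curve_monoid a)"
  then obtain h where h: "\<And>s. s \<in> Poly_Mapping.keys q \<Longrightarrow> Poly_Mapping.keys (h s) \<subseteq> {0..length a} \<and> s = monomial_image a (h s)"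
    unfolding supported_def curve_monoid_def
    by (metis (mono_tags, lifting) image_iff mem_Collect_eq subsetD)
  have inj: "inj_on h (Poly_Mapping.keys q)"
    by (rule inj_onI) (metis h)
  define p where "p = (\<Sum>s\<in>Poly_Mapping.keys q. Poly_Mapping.single (h s) (Poly_Mapping.lookup q s))"
  have keys: "Poly_Mapping.keys p \<subseteq> h ` Poly_Mapping.keys q"
    unfolding p_def by (rule keys_sum_subset) auto
  have lookup: "Poly_Mapping.lookup p (h s) = Poly_Mapping.lookup q s" if "s \<in> Poly_Mapping.keys q" for s
  proof -
    have "Poly_Mapping.lookup p (h s) = (\<Sum>t\<in>Poly_Mapping.keys q. if t = s then Poly_Mapping.lookup q t else 0)"
      unfolding p_def lookup_sum lookup_single when_def
      by (rule sum.cong) (use inj that in \<open>auto dest: inj_onD\<close>)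
    then show ?thesis using that by simp
  qed
  have "curve_map a p = (\<Sum>s\<in>Poly_Mapping.keys q. Poly_Mapping.single (monomial_image a (h s)) (Poly_Mapping.lookup p (h s)))"
    by (simp add: curve_map_superset[OF _ keys] sum.reindex[OF inj])
  also have "\<dots> = (\<Sum>s\<in>Poly_Mapping.keys q. Poly_Mapping.single s (Poly_Mapping.lookup q s))"
    by (rule sum.cong) (use h lookup in auto)
  finally have "curve_map a p = q"
    by (simp add: poly_mapping_sum_single)
  moreover have "p \<in> poly_ring (length a)"
    using keys h by (fastforce simp: poly_ring_def)
  ultimately show "q \<in> coord_ring a"
    unfolding coord_ring_def by blast
qed

section \<open>Symmetric semigroups\<close>

locale symmetric_semigroup =
  fixes T :: "nat set"
  assumes numerical: "numerical_semigroup T" and symmetric: "symmetric_sg T" and two_notin: "2 \<notin> T"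
begin

abbreviation F :: nat where "F \<equiv> frobenius T"

lemma zero_mem: "0 \<in> T"
  and add_mem: "x \<in> T \<Longrightarrow> y \<in> T \<Longrightarrow> x + y \<in> T"
  using numerical by (auto simp: numerical_semigroup_def)

lemma multiple_mem: "x \<in> T \<Longrightarrow> n * x \<in> T"
  by (induction n) (auto simp: zero_mem add_mem)

lemma frobenius_notin: "F \<notin> T"
  and mem_above_frobenius: "x > F \<Longrightarrow> x \<in> T"
proof -
  have fin: "finite (UNIV - T)"
    using numerical by (simp add: numerical_semigroup_def)
  show "F \<notin> T"
    \<comment> \<open>\<open>2\<close> witnesses that the complement is nonempty, so the maximum is
      attained in it.\<close>
    using Max_in[OF fin] two_notin by (auto simp: frobenius_def)
  show "x \<in> T" if "x > F"
    using Max_ge[OF fin, of x] that by (force simp: frobenius_def)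
qed

text \<open>Symmetry puts at least one of \<open>x\<close> and \<open>F - x\<close> in
  \<open>T\<close>; both cannot be there, since their sum \<open>F\<close> is a gap.\<close>

lemma mem_iff_complement_notin: "x \<le> F \<Longrightarrow> x \<in> T \<longleftrightarrow> F - x \<notin> T"
  using symmetric add_mem[of x "F - x"] frobenius_notin by (auto simp: symmetric_sg_def)

lemma one_notin: "1 \<notin> T"
  using add_mem[of 1 1] two_notin by (auto simp: numeral_2_eq_2)

lemma frobenius_ge_5: "F \<ge> 5"
  and frobenius_minus_1_mem: "F - 1 \<in> T"
  and frobenius_minus_2_mem: "F - 2 \<in> T"
proof -
  have "F \<ge> 2"
    using mem_above_frobenius[of 2] two_notin by force
  then show F1: "F - 1 \<in> T" and F2: "F - 2 \<in> T"
    using mem_iff_complement_notin[of 1] mem_iff_complement_notin[of 2] one_notin two_notin by auto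
  \<comment> \<open>Each of these values would make \<open>F - 1\<close> or \<open>F - 2\<close>
    equal to \<open>1\<close> or \<open>2\<close>.\<close>
  have "F \<noteq> 2" "F \<noteq> 3" "F \<noteq> 4"
    using F1 F2 one_notin two_notin by auto
  with \<open>F \<ge> 2\<close> show "F \<ge> 5" by linarith
qed

text \<open>By symmetry \<open>F - (x - j)\<close> is then in \<open>T\<close>, so \<open>F + j\<close> is a sum of two elements of \<open>T\<close> below \<open>F\<close>.
  If no such \<open>x\<close> existed, \<open>T \<inter> [0, F - 1]\<close> would consist of multiples of its least positive
  element, although it contains \<open>F - 1\<close> and \<open>F - 2\<close>.\<close>
lemma exists_mem_shift_notin:
  assumes "1 \<le> j" "j \<le> F - 2"
  shows "\<exists>x\<in>T. j < x \<and> x \<le> F - 1 \<and> x - j \<notin> T"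
proof (rule ccontr)
  assume "\<not> ?thesis"
  then have shift: "x - j \<in> T" if "x \<in> T" "j < x" "x \<le> F - 1" for x
    using that by blast
  define e where "e = (LEAST e. e \<in> T \<and> e > 0)"
  have e: "e \<in> T \<and> e > 0"
    unfolding e_def by (rule LeastI[of _ "F - 1"]) (use frobenius_minus_1_mem frobenius_ge_5 in auto)
  have e_le: "e \<le> x" if "x \<in> T" "x > 0" for x
    unfolding e_def by (rule Least_le) (use that in auto)
  have "e \<le> F - 1 - j"
    by (rule e_le) (use shift[OF frobenius_minus_1_mem] assms frobenius_ge_5 in auto)
  \<comment> \<open>Thus \<open>shift\<close> applies to every element of \<open>T\<close> in the
    window from \<open>j + 1\<close> to \<open>j + e\<close>.\<close>
  then have je: "j + e \<le> F - 1"
    using e assms by linarith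
  \<comment> \<open>\<open>t'\<close> is the first term of \<open>t, t + e, t + 2 * e, ...\<close>
    beyond \<open>j\<close>. Then \<open>t' - j\<close> is a positive element of \<open>T\<close> of
    size at most \<open>e\<close>, hence equal to \<open>e\<close>.\<close>
  have small: "e dvd j - t" if "t \<in> T" "t \<le> j" for t
  proof -
    obtain q r where qr: "j - t = q * e + r" "r < e"
      using e by (metis div_mult_mod_eq mod_less_divisor)
    define t' where "t' = t + (q + 1) * e"
    have t': "j < t'" "t' \<le> j + e"
      using that(2) qr unfolding t'_def by (simp_all add: distrib_right)
    have "t' \<in> T"
      unfolding t'_def by (intro add_mem multiple_mem that) (use e in auto)
    then have "t' - j \<in> T"
      using shift t' je by simp
    then have "e \<le> t' - j"
      using e_le t'(1) by simp
    then have "j - t = q * e"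
      using t' that(2) unfolding t'_def by (simp add: distrib_right)
    then show ?thesis by simp
  qed
  have ej: "e dvd j"
    using small[OF zero_mem] by simp
  have all: "e dvd t" if "t \<in> T" "t \<le> F - 1" for t
    using that
  proof (induction t rule: less_induct)
    case (less t)
    show ?case
    proof (cases "t \<le> j")
      case True
      then show ?thesis
        using small[OF less.prems(1)] ej by (metis dvd_diffD1)
    next
      case False
      then have "e dvd t - j"
        using less.IH[of "t - j"] shift[of t] less.prems assms(1) by simp
      then show ?thesis
        using ej False by (metis dvd_diffD le_cases)
    qed
  qed
  have "e dvd F - 1" "e dvd F - 2"
    using all frobenius_minus_1_mem frobenius_minus_2_mem by auto
  then have "e dvd (F - 1) - (F - 2)"
    by (rule dvd_diff_nat)
  moreover have "(F - 1) - (F - 2) = 1"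
    using frobenius_ge_5 by simp
  ultimately show False
    using e one_notin by simp
qed

section \<open>The exponent monoid of the curve\<close>

text \<open>\<open>F - 1\<close> is the degree \<open>d\<close> of the curve, and
  \<open>(x + y) / d\<close> is the degree of the monomial \<open>u^x v^y\<close> in the standard
  grading.\<close>

definition cone :: "(nat \<times> nat) set" where
  "cone = {(x, y). x \<in> T \<and> F - 1 dvd x + y}"

lemma submonoid_cone: "submonoid cone"
proof -
  have "F - 1 dvd (x + y) + (x' + y')" if "F - 1 dvd x + y" "F - 1 dvd x' + y'" for x y x' y'
    using that by (rule dvd_add)
  then show ?thesis
    by (auto simp: submonoid_def cone_def zero_prod_def zero_mem add_mem add.assoc add.left_commute)
qed

text \<open>Induction on the degree \<open>m\<close> of \<open>(x, m * d - x)\<close>, where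
  \<open>d = F - 1\<close>. Degree one consists of generators. Above it, \<open>(0, d)\<close> or
  \<open>(d, 0)\<close> is split off, except for \<open>F < x\<close> in degree two, where symmetry
  gives a decomposition, and for \<open>x = 2 * d + 1\<close> in degree three.\<close>

lemma cone_subset_submonoid:
  assumes S: "submonoid S" and gen: "\<And>t. t \<in> T \<Longrightarrow> t < F \<Longrightarrow> (t, F - 1 - t) \<in> S"
  shows "cone \<subseteq> S"
proof -
  let ?d = "F - 1"
  have d: "?d \<ge> 4" using frobenius_ge_5 by simp
  have v: "(0, ?d) \<in> S"
    using gen[of 0] zero_mem d by simp
  have u: "(?d, 0) \<in> S"
    using gen[of ?d] frobenius_minus_1_mem d by simp
  have main: "(x, m * ?d - x) \<in> S" if "x \<in> T" "x \<le> m * ?d" for m x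
    using that
  proof (induction m arbitrary: x)
    case 0
    then show ?case
      using submonoid_0[OF S] by (simp add: zero_prod_def)
  next
    case (Suc m)
    have "m = 0 \<or> m = 1 \<or> m \<ge> 2" by linarith
    then consider "x \<le> m * ?d" | "m = 0" | "m = 1" "x > m * ?d"
      | "m \<ge> 2" "x > m * ?d" "x - ?d \<in> T" | "m \<ge> 2" "x > m * ?d" "x - ?d \<notin> T"
      unfolding not_le[symmetric] by blast
    then show ?case
    proof cases
      case 1
      then have "(x, m * ?d - x) + (0, ?d) \<in> S"
        using Suc v submonoid_add[OF S] by blast
      then show ?thesis using 1 by (simp add: add.commute)
    next
      case 2
      then show ?thesis using gen[of x] Suc.prems d by simp
    next
      case 3
      have "x \<noteq> F"
        using Suc.prems(1) frobenius_notin by blast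
      then have x: "x > F" "x \<le> 2 * ?d"
        using 3 Suc.prems(2) by auto
      then have "1 \<le> x - F" "x - F \<le> F - 2" by auto
      \<comment> \<open>The shift is \<open>j = x - F\<close>, and \<open>x = z + (x - z)\<close>
        will be the decomposition into two elements of \<open>T\<close> below
        \<open>F\<close>.\<close>
      then obtain z where z: "z \<in> T" "x - F < z" "z \<le> ?d" "z - (x - F) \<notin> T"
        using exists_mem_shift_notin by blast
      then have "F - (z - (x - F)) \<in> T"
        using mem_iff_complement_notin[of "z - (x - F)"] d by auto
      moreover have w: "F - (z - (x - F)) = x - z" "x - z < F"
        using z x d by auto
      ultimately have "(x - z, ?d - (x - z)) \<in> S"
        using gen[of "x - z"] by metis
      moreover have "(z, ?d - z) \<in> S"
        using gen[of z] z d by simp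
      ultimately have "(z, ?d - z) + (x - z, ?d - (x - z)) \<in> S"
        by (intro submonoid_add[OF S])
      moreover have "?d - z + (?d - (x - z)) = 2 * ?d - x"
      proof -
        have "e - z + (e - (x - z)) = 2 * e - x" if "z \<le> e" "z \<le> x" "x - z \<le> e" for e
          using that by auto
        then show ?thesis using z(3) x w(2) by simp
      qed
      ultimately show ?thesis
        using z x 3 by simp
    next
      case 4
      then have "x \<ge> ?d" by (metis le_trans less_imp_le_nat mult_le_mono1 mult_1 one_le_numeral)
      have "x - ?d \<le> m * ?d"
        using Suc.prems(2) by simp
      then have "(x - ?d, m * ?d - (x - ?d)) \<in> S"
        using Suc.IH 4(3) by blast
      then have "(x - ?d, m * ?d - (x - ?d)) + (?d, 0) \<in> S"
        using u by (rule submonoid_add[OF S])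
      moreover have "x - ?d + ?d = x" "m * ?d - (x - ?d) + 0 = Suc m * ?d - x"
        using \<open>x \<ge> ?d\<close> by simp_all
      ultimately show ?thesis by (simp only: add_Pair)
    next
      case 5
      have "x - ?d \<le> F"
        using 5(3) mem_above_frobenius by (meson not_less)
      \<comment> \<open>The gap \<open>x - d\<close> gives \<open>x <= F + d = 2 * d + 1\<close>,
        while \<open>x > m * d\<close>; only \<open>m = 2\<close> and \<open>x = 2 * d + 1\<close>
        survive.\<close>
      have "m < 3"
      proof (rule ccontr)
        assume "\<not> m < 3"
        then have "3 * ?d \<le> m * ?d" by (intro mult_le_mono1) simp
        then show False using \<open>x - ?d \<le> F\<close> 5 d by linarith
      qed
      with 5(1) have "m = 2" by simp
      with 5(2) \<open>x - ?d \<le> F\<close> d have m: "m = 2" "x = 2 * ?d + 1" by auto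
      \<comment> \<open>Split \<open>2 * d + 1 = (d + 2) + (d - 1)\<close>, where
        \<open>d + 2 = F + 1\<close> lies above \<open>F\<close> and \<open>d - 1 = F - 2\<close> is
        in \<open>T\<close>.\<close>
      have "(?d + 2, 2 * ?d - (?d + 2)) \<in> S"
        using Suc.IH[of "?d + 2"] mem_above_frobenius[of "?d + 2"] d by (simp add: m)
      moreover have "(?d - 1, 1) \<in> S"
        using gen[of "F - 2"] frobenius_minus_2_mem d by (simp add: numeral_2_eq_2)
      ultimately have "(?d + 2, 2 * ?d - (?d + 2)) + (?d - 1, 1) \<in> S"
        by (rule submonoid_add[OF S])
      moreover have "?d + 2 + (?d - 1) = x" "2 * ?d - (?d + 2) + 1 = Suc m * ?d - x"
        using d by (auto simp: m)
      ultimately show ?thesis by (simp only: add_Pair)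
    qed
  qed
  show ?thesis
  proof
    fix s assume "s \<in> cone"
    then obtain x y m where s: "s = (x, y)" "x \<in> T" "x + y = m * ?d"
      by (auto simp: cone_def dvd_def mult.commute)
    then have "y = m * ?d - x" "x \<le> m * ?d" by auto
    then show "s \<in> S" using main[of x m] s by simp
  qed
qed

lemma curve_monoid_eq_cone:
  assumes "sorted_wrt (<) a" and a: "set a = {t \<in> T. 0 < t \<and> t < F}"
  shows "curve_monoid a = cone"
proof -
  let ?d = "F - 1"
  have d: "?d \<ge> 4" using frobenius_ge_5 by simp
  have mem: "?d \<in> set a"
    using a d frobenius_minus_1_mem by auto
  have "x \<le> last a" if "x \<in> set a" for x
    using assms(1) that by (induction a) (auto intro: less_imp_le)
  then have "last a = ?d"
    using mem a last_in_set[of a] by force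
  then have gen: "curve_gen a 0 = (0, ?d)" "\<And>i. 0 < i \<Longrightarrow> curve_gen a i = (a ! (i - 1), ?d - a ! (i - 1))"
    by (auto simp: curve_gen_def Let_def)
  show ?thesis
  proof
    have "curve_gen a i \<in> cone" if "i \<le> length a" for i
    proof (cases "i = 0")
      case True
      then show ?thesis by (simp add: gen cone_def zero_mem)
    next
      case False
      then have "a ! (i - 1) \<in> set a" using that by (intro nth_mem) auto
      then show ?thesis using False a by (auto simp: gen cone_def)
    qed
    then show "curve_monoid a \<subseteq> cone"
      by (rule curve_monoid_subset[OF submonoid_cone])
    have "(t, ?d - t) \<in> curve_monoid a" if "t \<in> T" "t < F" for t
    \<comment> \<open>The value \<open>0\<close> is absent from \<open>a\<close>; its point is the
      generator of index \<open>0\<close>, and the entry \<open>a ! i\<close> belongs to index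
      \<open>Suc i\<close>.\<close>
    proof (cases "t = 0")
      case True
      then show ?thesis using curve_gen_in_curve_monoid[of 0 a] gen by simp
    next
      case False
      then have "t \<in> set a" using that a by simp
      then obtain i where "i < length a" "a ! i = t" by (auto simp: in_set_conv_nth)
      then show ?thesis using curve_gen_in_curve_monoid[of "Suc i" a] gen(2)[of "Suc i"] by simp
    qed
    then show "cone \<subseteq> curve_monoid a"
      by (rule cone_subset_submonoid[OF submonoid_curve_monoid])
  qed
qed

section \<open>The parameters \<open>v^d\<close> and \<open>u^d\<close>, and the socle modulo
  them\<close>

lemma u_power_in_cone: "(F - 1, 0) \<in> cone"
  and v_power_in_cone: "(0, F - 1) \<in> cone"
  using frobenius_minus_1_mem zero_mem by (auto simp: cone_def)

text \<open>The monomials in the ideal generated by \<open>v^d\<close> and \<open>u^d\<close>, where \<open>d = F - 1\<close>.\<close>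
definition parameter_monomials :: "(nat \<times> nat) set" where
  "parameter_monomials = (\<lambda>t. t + (0, F - 1)) ` cone \<union> (\<lambda>t. t + (F - 1, 0)) ` cone"

text \<open>The condition is asymmetric: removing \<open>v^d\<close> leaves \<open>x\<close> alone,
  whereas removing \<open>u^d\<close> must keep the first coordinate in \<open>T\<close>.\<close>

lemma parameter_monomials_iff:
  "(x, y) \<in> parameter_monomials \<longleftrightarrow> (x, y) \<in> cone \<and> (F - 1 \<le> y \<or> F - 1 \<le> x \<and> x - (F - 1) \<in> T)"
proof
  assume "(x, y) \<in> parameter_monomials"
  then show "(x, y) \<in> cone \<and> (F - 1 \<le> y \<or> F - 1 \<le> x \<and> x - (F - 1) \<in> T)"
    unfolding parameter_monomials_def
    using submonoid_add[OF submonoid_cone _ u_power_in_cone] submonoid_add[OF submonoid_cone _ v_power_in_cone]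
    by (force simp: cone_def)
next
  let ?d = "F - 1"
  assume *: "(x, y) \<in> cone \<and> (?d \<le> y \<or> ?d \<le> x \<and> x - ?d \<in> T)"
  then consider "?d \<le> y" | "?d \<le> x" "x - ?d \<in> T" by blast
  then show "(x, y) \<in> parameter_monomials"
  proof cases
    case 1
    then have "(x, y) = (x, y - ?d) + (0, ?d)" by simp
    moreover have "(x, y - ?d) \<in> cone"
      using * 1 dvd_diff_nat[of ?d "x + y" ?d] by (auto simp: cone_def)
    ultimately show ?thesis unfolding parameter_monomials_def by blast
  next
    case 2
    then have "(x, y) = (x - ?d, y) + (?d, 0)" by simp
    moreover have "(x - ?d, y) \<in> cone"
      using * 2 dvd_diff_nat[of ?d "x + y" ?d] by (auto simp: cone_def)
    ultimately show ?thesis unfolding parameter_monomials_def by blast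
  qed
qed

text \<open>With \<open>d = F - 1\<close> this is \<open>(F + d, d - 1)\<close>: the largest element
  of the Apery set of \<open>T\<close> with respect to \<open>d\<close>, paired with the largest
  exponent of \<open>v\<close> below \<open>d\<close>.\<close>

definition socle_monomial :: "nat \<times> nat" where
  "socle_monomial = (2 * F - 1, F - 2)"

lemma socle_monomial_in_cone: "socle_monomial \<in> cone"
proof -
  have eq: "2 * F - 1 + (F - 2) = 3 * (F - 1)" using frobenius_ge_5 by simp
  have "F - 1 dvd 2 * F - 1 + (F - 2)" unfolding eq by simp
  moreover have "2 * F - 1 \<in> T"
    using mem_above_frobenius frobenius_ge_5 by simp
  ultimately show ?thesis
    unfolding socle_monomial_def cone_def by blast
qed

text \<open>The exponent \<open>F - 2\<close> is too small to remove \<open>v^d\<close>, and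
  removing \<open>u^d\<close> leaves the gap \<open>F\<close>.\<close>

lemma socle_monomial_notin_parameter_monomials: "socle_monomial \<notin> parameter_monomials"
proof -
  have "2 * F - 1 - (F - 1) = F" "\<not> F - 1 \<le> F - 2" using frobenius_ge_5 by auto
  then show ?thesis
    using frobenius_ge_5 frobenius_notin by (simp add: socle_monomial_def parameter_monomials_iff)
qed

text \<open>A positive second coordinate of \<open>g\<close> makes \<open>v^d\<close> removable;
  otherwise the first is positive, and removing \<open>u^d\<close> leaves a number above
  \<open>F\<close>.\<close>

lemma socle_monomial_add_in_parameter_monomials:
  assumes "g \<in> cone" "g \<noteq> 0"
  shows "socle_monomial + g \<in> parameter_monomials"
proof -
  obtain x y where g: "g = (x, y)" by (cases g)
  have "socle_monomial + g \<in> cone"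
    by (rule submonoid_add[OF submonoid_cone socle_monomial_in_cone assms(1)])
  moreover have "F - 1 \<le> F - 2 + y \<or> 2 * F - 1 + x - (F - 1) \<in> T"
  proof (cases "y = 0")
    case True
    then have "x > 0" using assms(2) by (simp add: g zero_prod_def)
    moreover have "2 * F - 1 + x - (F - 1) = F + x" using frobenius_ge_5 by simp
    ultimately show ?thesis using mem_above_frobenius[of "F + x"] by simp
  qed auto
  ultimately show ?thesis
    by (auto simp: g socle_monomial_def parameter_monomials_iff)
qed

text \<open>The Apery set of \<open>T\<close> with respect to \<open>d = F - 1\<close> is symmetric about \<open>F + d\<close>.\<close>
lemma complement_to_socle_monomial:
  assumes "s \<in> cone" "s \<notin> parameter_monomials"
  obtains g where "g \<in> cone" "s + g = socle_monomial"
proof -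
  let ?d = "F - 1"
  obtain x y where s: "s = (x, y)" by (cases s)
  have xy: "x \<in> T" "F - 1 dvd x + y" "y < ?d" "x < ?d \<or> x - ?d \<notin> T"
    using assms by (auto simp: s parameter_monomials_iff cone_def)
  have x_le: "x \<le> 2 * F - 1"
    using xy(4) mem_above_frobenius[of "x - ?d"] by force
  have "2 * F - 1 - x \<in> T"
  \<comment> \<open>Below \<open>d\<close> the difference exceeds \<open>F\<close>; otherwise it
    equals \<open>F - (x - d)\<close> with \<open>x - d\<close> a gap, and symmetry applies.\<close>
  proof (cases "x < ?d")
    case True
    then show ?thesis using mem_above_frobenius[of "2 * F - 1 - x"] by simp
  next
    case False
    then have "F - (x - ?d) \<in> T"
      using xy(4) x_le mem_iff_complement_notin[of "x - ?d"] by auto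
    moreover have "F - (x - ?d) = 2 * F - 1 - x" using False frobenius_ge_5 by simp
    ultimately show ?thesis by metis
  qed
  moreover have "F - 1 dvd (2 * F - 1 - x) + (F - 2 - y)"
  proof -
    have "(2 * F - 1 - x) + (F - 2 - y) = 3 * ?d - (x + y)"
      using x_le xy(3) frobenius_ge_5 by simp
    then show ?thesis using xy(2) by simp
  qed
  ultimately have "(2 * F - 1 - x, F - 2 - y) \<in> cone"
    by (simp add: cone_def)
  moreover have "s + (2 * F - 1 - x, F - 2 - y) = socle_monomial"
    using x_le xy(3) by (simp add: s socle_monomial_def)
  ultimately show ?thesis by (rule that)
qed

text \<open>Multiplying by a monomial only shifts coefficients, so \<open>v^d\<close> is a
  nonzerodivisor. Within \<open>cone\<close>, divisibility by \<open>v^d\<close> depends only on the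
  exponent of \<open>v\<close>, which multiplication by \<open>u^d\<close> does not change.\<close>

lemma regular_seq_v_u:
  "regular_seq (supported cone) {r \<in> supported cone. Poly_Mapping.lookup r (0, 0) = 0}
     [Poly_Mapping.single (0, F - 1) (1::'k::field), Poly_Mapping.single (F - 1, 0) 1]"
    (is "regular_seq ?A ?m [?v, ?u]")
proof -
  let ?d = "F - 1"
  note S = submonoid_cone
  have d: "?d > 0" using frobenius_ge_5 by simp
  have "?v \<in> ?A" "?u \<in> ?A"
    by (intro supported_single u_power_in_cone v_power_in_cone)+
  then have "set [?v, ?u] \<subseteq> ?m"
    using d by (auto simp: lookup_single when_def)
  moreover have "y = 0" if "y * ?v = 0" for y :: "'k uvpoly"
  proof (rule poly_mapping_eqI)
    fix s
    show "Poly_Mapping.lookup y s = Poly_Mapping.lookup 0 s"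
      using lookup_mult_single_shift[of y "(0, ?d)" 1 s] that by simp
  qed
  moreover have "y \<in> gen_ideal ?A [?v]" if y: "y \<in> ?A" "y * ?u \<in> gen_ideal ?A [?v]" for y :: "'k uvpoly"
  proof -
    have y_u: "y * ?u \<in> supported ((\<lambda>t. t + (0, ?d)) ` cone)"
      using y(2) unfolding gen_ideal_monomial[OF S v_power_in_cone] .
    have "s \<in> (\<lambda>t. t + (0, ?d)) ` cone" if s: "s \<in> Poly_Mapping.keys y" for s
    proof -
      have "s + (?d, 0) \<in> Poly_Mapping.keys (y * ?u)"
        using s by (simp add: in_keys_iff lookup_mult_single_shift)
      then have "s + (?d, 0) \<in> (\<lambda>t. t + (0, ?d)) ` cone"
        using y_u by (auto simp: supported_def)
      then have le: "?d \<le> snd s" by (cases s) auto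
      have "s \<in> cone" using y(1) s by (auto simp: supported_def)
      then have "(fst s, snd s - ?d) \<in> cone"
        using le dvd_diff_nat[of ?d "fst s + snd s" ?d] by (cases s) (auto simp: cone_def)
      moreover have "s = (fst s, snd s - ?d) + (0, ?d)"
        using le by (cases s) simp
      ultimately show ?thesis by blast
    qed
    then show ?thesis
      unfolding gen_ideal_monomial[OF S v_power_in_cone] by (auto simp: supported_def)
  qed
  moreover have "1 \<notin> gen_ideal ?A [?v, ?u]"
    using d unfolding gen_ideal_two_monomials[OF S v_power_in_cone u_power_in_cone]
    by (auto simp: supported_def zero_prod_def)
  ultimately show ?thesis
    unfolding regular_seq_def by (auto simp: less_Suc_eq gen_ideal_Nil)
qed

text \<open>If a socle element had a key \<open>s\<close> outside \<open>parameter_monomials\<close>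
  other than \<open>socle_monomial\<close>, a nonconstant monomial would carry \<open>s\<close> to
  \<open>socle_monomial\<close>, which is not in the ideal. So the socle is spanned by
  \<open>socle_monomial\<close> modulo the ideal.\<close>

lemma gorenstein_cone:
  "gorenstein_wrt (\<lambda>c::'k::field. Poly_Mapping.single (0, 0) c) (supported cone)
     {r \<in> supported cone. Poly_Mapping.lookup r (0, 0) = 0}"
    (is "gorenstein_wrt _ ?A ?m")
proof -
  let ?d = "F - 1"
  let ?xs = "[Poly_Mapping.single (0, ?d) (1::'k), Poly_Mapping.single (?d, 0) 1]"
  have d: "?d > 0" using frobenius_ge_5 by simp
  have J: "gen_ideal ?A ?xs = supported parameter_monomials"
    unfolding parameter_monomials_def
    by (rule gen_ideal_two_monomials[OF submonoid_cone v_power_in_cone u_power_in_cone])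
  let ?s = "Poly_Mapping.single socle_monomial (1::'k)"
  have "?s \<in> socle ?A ?m (supported parameter_monomials)"
  proof -
    have "?s * y \<in> supported parameter_monomials" if "y \<in> ?m" for y
    proof -
      have "Poly_Mapping.keys y \<subseteq> cone - {0}"
        using that by (auto simp: supported_def in_keys_iff zero_prod_def)
      then show ?thesis
        unfolding supported_def mem_Collect_eq
        by (intro keys_mult_subset[of ?s "{socle_monomial}" y "cone - {0}"])
          (auto intro: socle_monomial_add_in_parameter_monomials)
    qed
    then show ?thesis
      by (simp add: socle_def supported_single socle_monomial_in_cone)
  qed
  moreover have "?s \<notin> supported parameter_monomials"
    by (simp add: supported_def socle_monomial_notin_parameter_monomials)
  moreover have "\<exists>c. r - Poly_Mapping.single (0, 0) c * ?s \<in> supported parameter_monomials"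
    if r: "r \<in> socle ?A ?m (supported parameter_monomials)" for r
  proof
    \<comment> \<open>This scalar cancels \<open>socle_monomial\<close> from the keys of
      \<open>r\<close>; all other keys must then lie in \<open>parameter_monomials\<close>.\<close>
    let ?c = "Poly_Mapping.lookup r socle_monomial"
    have eq: "r - Poly_Mapping.single (0, 0) ?c * ?s = r - Poly_Mapping.single socle_monomial ?c"
      by (simp add: mult_single flip: zero_prod_def)
    have "s \<in> parameter_monomials" if s: "s \<in> Poly_Mapping.keys r" "s \<noteq> socle_monomial" for s
    proof (rule ccontr)
      assume notin: "s \<notin> parameter_monomials"
      have "s \<in> cone" using r s(1) by (auto simp: socle_def supported_def)
      then obtain g where g: "g \<in> cone" "s + g = socle_monomial"
        using notin by (rule complement_to_socle_monomial)
      then have "g \<noteq> 0" using s(2) by auto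
      then have "Poly_Mapping.single g (1::'k) \<in> ?m"
        using g by (auto simp: supported_single lookup_single when_def zero_prod_def)
      then have "r * Poly_Mapping.single g 1 \<in> supported parameter_monomials"
        using r by (simp add: socle_def)
      moreover have "socle_monomial \<in> Poly_Mapping.keys (r * Poly_Mapping.single g 1)"
        using lookup_mult_single_shift[of r g 1 s] s(1) g(2) by (simp add: in_keys_iff)
      ultimately show False
        using socle_monomial_notin_parameter_monomials by (auto simp: supported_def)
    qed
    then show "r - Poly_Mapping.single (0, 0) ?c * ?s \<in> supported parameter_monomials"
      unfolding eq supported_def
      by (auto simp: in_keys_iff lookup_minus lookup_single when_def split: if_splits)
  qed
  moreover have "krull_dim ?A = enat (length ?xs)"
    using krull_dim_supported_eq_2[OF submonoid_cone v_power_in_cone u_power_in_cone d]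
    by (simp add: numeral_eq_enat numeral_2_eq_2)
  ultimately show ?thesis
    using regular_seq_v_u unfolding gorenstein_wrt_def Let_def
    by (intro exI[of _ ?xs]) (unfold J, blast intro: sym)
qed

end

theorem mainTheorem12:
  fixes T :: "nat set" and a :: "nat list"
  assumes "infinite (UNIV :: 'k::field set)"
    and "numerical_semigroup T"
    and "symmetric_sg T"
    and "2 \<notin> T"
    and "sorted_wrt (<) a"
    and "set a = {t \<in> T. 0 < t \<and> t < frobenius T}"
  shows "arith_gorenstein TYPE('k) a"
proof -
  interpret symmetric_semigroup T
    using assms by unfold_locales
  have "(coord_ring a :: 'k uvpoly set) = supported cone"
    using assms by (simp add: coord_ring_eq_supported curve_monoid_eq_cone)
  then show ?thesis
    unfolding arith_gorenstein_def coord_irrelevant_def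
    using gorenstein_cone[where ?'k = 'k] by simp
qed

end
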